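(* Let $X$ be a real Hilbert space, let $\mathcal{A}$ be a nonempty finite collection of closed affine subspaces of $X$, and let $\mathcal{L}$ be the collection of closed linear subspaces parallel to the members of $\mathcal{A}$. Suppose that $\mathcal{L}$ is innately regular and that $0<\lambda<2$. Then there exists a positive constant $C_{\mathcal{A},\lambda}<+\infty$ such that for any sequence $(A_n)_{n\in\mathbb{N}}$ drawn from $\mathcal{A}$, with associated linear subspaces $(L_n)_{n\in\mathbb{N}}$ in $\mathcal{L}$ and translation vectors $(a_n)_{n\in\mathbb{N}}$ (so $A_n=a_n+L_n$ with $a_n\in L_n^\perp$), and any starting point $x_0\in X$, the sequence $(x_n)_{n\in\mathbb{N}}$ generated by the iteration $$x_{n+1}:=R_{A_n,\lambda}x_n=R_nx_n+\lambda a_n,\qquad\text{where } R_n:=R_{L_n,\lambda},$$ satisfies $$(\forall n\in\mathbb{N})\quad \Big\|\sum_{j=0}^n R_n\cdots R_{j+1}a_j\Big\|\leq C_{\mathcal{A},\lambda};$$ consequently, $$(\forall n\in\mathbb{N})\quad\|x_n\|\leq\|x_0\|+\lambda C_{\mathcal{A},\lambda}.$$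
   Context: The index set is $\mathbb{N}=\{0,1,2,\dots\}$. $X$ is a real Hilbert space (possibly infinite-dimensional) with inner product $\langle\cdot,\cdot\rangle$ and induced norm $\|\cdot\|$. A closed affine subspace is a nonempty set $A=a+L$ with $a\in X$ and $L$ a closed linear subspace of $X$; then $L=A-A$ is the linear subspace parallel to (associated with) $A$, and $\mathcal{L}=\{A-A : A\in\mathcal{A}\}$. The translation vector of $A$ is the unique vector $a\in L^\perp\cap A$, i.e. $\{a\}=P_{L^\perp}(A)$, so that $A=a+L$. For a nonempty closed convex subset $C$ of $X$, $P_C$ denotes the orthogonal (nearest point) projector onto $C$, and for $\mu\in\mathbb{R}$, $R_{C,\mu}:=(1-\mu)\mathrm{Id}+\mu P_C$, where $\mathrm{Id}$ is the identity on $X$. The distance function is $d_C(x):=\inf_{c\in C}\|x-c\|$. The empty product convention is used: $R_n\cdots R_{j+1}=\mathrm{Id}$ when $j=n$. A finite nonempty collection $\mathcal{M}$ of closed linear subspaces of $X$ is called regular if there exists a constant $\kappa>0$ such that $d_{\bigcap_{L\in\mathcal{M}}L}(x)\leq\kappa\max_{L\in\mathcal{M}}d_L(x)$ for all $x\in X$. The collection $\mathcal{L}$ is called innately regular if every (nonempty) subcollection of $\mathcal{L}$ is regular. *)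

theory Defs
  imports "HOL-Analysis.Analysis"
begin

(* Real Hilbert spaces are rendered by the sort {real_inner, complete_space}. *)

definition closed_subspace :: "'a::real_inner set \<Rightarrow> bool" where
  "closed_subspace L \<longleftrightarrow> subspace L \<and> closed L"

definition closed_affine_subspace :: "'a::real_inner set \<Rightarrow> bool" where
  "closed_affine_subspace A \<longleftrightarrow> (\<exists>a L. closed_subspace L \<and> A = (+) a ` L)"

(* The Minkowski difference A - A; the minus sign on sets is set difference in HOL. *)
definition parallel_subspace :: "'a::real_inner set \<Rightarrow> 'a set" where
  "parallel_subspace A = {x - y | x y. x \<in> A \<and> y \<in> A}"

definition translation_vector :: "'a::real_inner set \<Rightarrow> 'a" where
  "translation_vector A = (THE a. a \<in> orthogonal_comp (parallel_subspace A) \<inter> A)"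

(* The library's closest_point requires the class heine_borel, hence finite dimension;
   on nonempty closed convex sets of a Hilbert space the description below is proper. *)
definition projector :: "'a::real_inner set \<Rightarrow> 'a \<Rightarrow> 'a" where
  "projector C x = (THE p. p \<in> C \<and> (\<forall>c\<in>C. dist x p \<le> dist x c))"

definition relaxed_projector :: "'a::real_inner set \<Rightarrow> real \<Rightarrow> 'a \<Rightarrow> 'a" where
  "relaxed_projector C \<mu> x = (1 - \<mu>) *\<^sub>R x + \<mu> *\<^sub>R projector C x"

(* Meant for finite nonempty collections of closed linear subspaces. *)
definition regular_collection :: "'a::real_inner set set \<Rightarrow> bool" where
  "regular_collection M \<longleftrightarrow>
     (\<exists>\<kappa>>0. \<forall>x. infdist x (\<Inter>M) \<le> \<kappa> * Max ((\<lambda>L. infdist x L) ` M))"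

definition innately_regular :: "'a::real_inner set set \<Rightarrow> bool" where
  "innately_regular \<L> \<longleftrightarrow> (\<forall>M. M \<subseteq> \<L> \<and> M \<noteq> {} \<longrightarrow> regular_collection M)"

end

theory Submission
  imports Defs
begin

text \<open>
  With \<open>0 < \<lambda> < 2\<close>, a relaxed projection onto a subspace \<open>L\<close> loses the energy
  \<open>\<lambda> (2 - \<lambda>) d\<^sub>L(x)\<^sup>2\<close>. By induction on the number of subspaces in use, an orbit moves by at most
  \<open>sqrt K\<close> times the square root of the energy lost, independently of its length: each subspace
  \<open>L\<close> that occurs is close to the starting point, because the orbit has hardly moved when \<open>L\<close>
  is first used, and regularity turns this into closeness to the intersection \<open>V\<close> of these subspaces,
  whose points are fixed by the orbit. The same estimate shows that any orbit contracts the
  orthogonal complement of its own \<open>V\<close> by a uniform factor \<open>c < 1\<close>.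

  For affine subspaces, cut a word of projections before its shortest suffix that uses all
  the subspaces occurring in it. The linear part of this suffix contracts by \<open>c\<close>, since an orbit
  of \<open>0\<close> stays in the complement of \<open>V\<close>. After its first letter the suffix uses fewer subspaces, so
  its constant part is bounded by induction, and a geometric series bounds the whole orbit.
\<close>

section \<open>Nearest points and orthogonal projectors\<close>

lemma ex_closest_point:
  fixes C :: "'a::{real_inner, complete_space} set"
  assumes "convex C" "closed C" "C \<noteq> {}"
  shows "\<exists>p\<in>C. \<forall>c\<in>C. dist x p \<le> dist x c"
proof -
  define d where "d = infdist x C"
  have d0: "0 \<le> d" unfolding d_def by (rule infdist_nonneg)
  \<comment> \<open>The error of the minimizing sequence is imposed on squared distances because the
    parallelogram law, which will prove it Cauchy, is linear in these.\<close>
  have "\<exists>c\<in>C. (dist x c)\<^sup>2 < d\<^sup>2 + inverse (real (Suc n))" for n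
  proof -
    have "d < sqrt (d\<^sup>2 + inverse (real (Suc n)))"
      using d0 by (intro real_less_rsqrt) simp
    then have "(INF c\<in>C. dist x c) < sqrt (d\<^sup>2 + inverse (real (Suc n)))"
      by (simp only: d_def infdist_notempty[OF assms(3)])
    then obtain c where "c \<in> C" "dist x c < sqrt (d\<^sup>2 + inverse (real (Suc n)))"
      using cINF_less_iff[OF assms(3) bdd_below_image_dist] by blast
    moreover from this have "(dist x c)\<^sup>2 < (sqrt (d\<^sup>2 + inverse (real (Suc n))))\<^sup>2"
      by (intro power_strict_mono) auto
    ultimately show ?thesis by (intro bexI[of _ c]) auto
  qed
  then have "\<forall>n. \<exists>c. c \<in> C \<and> (dist x c)\<^sup>2 < d\<^sup>2 + inverse (real (Suc n))" by blast
  then obtain f where "\<forall>n. f n \<in> C \<and> (dist x (f n))\<^sup>2 < d\<^sup>2 + inverse (real (Suc n))"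
    by (rule choice[THEN exE])
  then have f: "f n \<in> C" "(dist x (f n))\<^sup>2 < d\<^sup>2 + inverse (real (Suc n))" for n by blast+
  have gap: "(dist (f m) (f n))\<^sup>2 \<le> 2 * inverse (real (Suc m)) + 2 * inverse (real (Suc n))" for m n
  proof -
    let ?q = "(1/2) *\<^sub>R f m + (1/2) *\<^sub>R f n"
    have "?q \<in> C" using f(1) by (intro convexD[OF assms(1)]) auto
    then have "d\<^sup>2 \<le> (dist x ?q)\<^sup>2"
      unfolding d_def by (intro power_mono infdist_le infdist_nonneg)
    \<comment> \<open>The parallelogram law for \<open>x - f m\<close> and \<open>x - f n\<close>.
      The midpoint \<open>?q\<close> lies in \<open>C\<close>, hence no closer to \<open>x\<close>
      than \<open>d\<close>, so two nearly optimal points must be close to each other.\<close>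
    moreover have "(dist (f m) (f n))\<^sup>2 = 2 * (dist x (f m))\<^sup>2 + 2 * (dist x (f n))\<^sup>2 - 4 * (dist x ?q)\<^sup>2"
    proof -
      define u v where "u = x - f m" and "v = x - f n"
      have "x - ?q = (1/2) *\<^sub>R (u + v)"
      proof -
        have "x = (1/2) *\<^sub>R x + (1/2) *\<^sub>R x" by (simp flip: scaleR_add_left)
        then show ?thesis by (simp add: u_def v_def scaleR_add_right scaleR_diff_right)
      qed
      then have "4 * (dist x ?q)\<^sup>2 = (norm (u + v))\<^sup>2"
        by (simp add: dist_norm power_divide)
      moreover have "dist (f m) (f n) = norm (u - v)"
        by (simp add: u_def v_def dist_norm norm_minus_commute)
      moreover have "(norm (u + v))\<^sup>2 + (norm (u - v))\<^sup>2 = 2 * (norm u)\<^sup>2 + 2 * (norm v)\<^sup>2"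
        by (simp add: power2_norm_eq_inner inner_diff_left inner_diff_right
            inner_add_left inner_add_right)
      ultimately show ?thesis by (simp add: dist_norm u_def v_def)
    qed
    ultimately show ?thesis using f(2)[of m] f(2)[of n] by linarith
  qed
  have "Cauchy f"
  proof (rule metric_CauchyI)
    fix e :: real assume "0 < e"
    then obtain N where N: "inverse (real (Suc N)) < e\<^sup>2 / 4"
      using reals_Archimedean[of "e\<^sup>2 / 4"] by auto
    show "\<exists>N. \<forall>m\<ge>N. \<forall>n\<ge>N. dist (f m) (f n) < e"
    proof (intro exI[of _ N] allI impI)
      fix m n assume mn: "N \<le> m" "N \<le> n"
      have "inverse (real (Suc m)) \<le> inverse (real (Suc N))"
        "inverse (real (Suc n)) \<le> inverse (real (Suc N))"
        using mn by (intro le_imp_inverse_le; simp)+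
      with gap[of m n] N have "(dist (f m) (f n))\<^sup>2 < e\<^sup>2" by linarith
      then show "dist (f m) (f n) < e"
        using \<open>0 < e\<close> by (simp add: power2_less_imp_less)
    qed
  qed
  then obtain p where p: "f \<longlonglongrightarrow> p"
    using Cauchy_convergent convergent_def by blast
  have pC: "p \<in> C"
    using closed_sequentially[OF assms(2) _ p] f(1) by blast
  have "(dist x p)\<^sup>2 \<le> d\<^sup>2"
  proof (rule LIMSEQ_le)
    show "(\<lambda>n. (dist x (f n))\<^sup>2) \<longlonglongrightarrow> (dist x p)\<^sup>2" by (intro tendsto_intros p)
    show "(\<lambda>n. d\<^sup>2 + inverse (real (Suc n))) \<longlonglongrightarrow> d\<^sup>2"
      using LIMSEQ_inverse_real_of_nat_add[of "d\<^sup>2"] by simp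
    show "\<exists>N. \<forall>n\<ge>N. (dist x (f n))\<^sup>2 \<le> d\<^sup>2 + inverse (real (Suc n))"
      by (intro exI allI impI less_imp_le f(2))
  qed
  then have "dist x p \<le> d" using d0 by (rule power2_le_imp_le)
  then have "\<forall>c\<in>C. dist x p \<le> dist x c"
    using order_trans[OF _ infdist_le[of _ C x]] unfolding d_def by fast
  with pC show ?thesis by blast
qed

lemma closest_point_subspace_orthogonal:
  fixes L :: "'a::real_inner set"
  assumes "subspace L" "p \<in> L" "\<forall>c\<in>L. dist x p \<le> dist x c" "l \<in> L"
  shows "(x - p) \<bullet> l = 0"
proof (cases "l = 0")
  case False
  then have l: "l \<bullet> l > 0" by simp
  \<comment> \<open>This \<open>t\<close> minimizes the quadratic
    \<open>norm (x - p - t *\<^sub>R l)\<close> squared. Its gain over \<open>t = 0\<close> is the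
    square of \<open>(x - p) \<bullet> l\<close> divided by \<open>l \<bullet> l\<close>, which the
    minimality of \<open>p\<close> forces to vanish.\<close>
  define t where "t = ((x - p) \<bullet> l) / (l \<bullet> l)"
  have "p + t *\<^sub>R l \<in> L" using assms by (intro subspace_add subspace_scale)
  then have "(dist x p)\<^sup>2 \<le> (dist x (p + t *\<^sub>R l))\<^sup>2"
    using assms(3) by (intro power_mono) auto
  also have "dist x (p + t *\<^sub>R l) = norm ((x - p) - t *\<^sub>R l)"
    by (simp add: dist_norm algebra_simps)
  also have "\<dots>\<^sup>2 = (dist x p)\<^sup>2 - 2 * t * ((x - p) \<bullet> l) + t\<^sup>2 * (l \<bullet> l)"
    by (simp add: dist_norm power2_norm_eq_inner inner_diff_left inner_diff_right
        inner_commute)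
      (simp add: power2_eq_square algebra_simps)
  also have "\<dots> = (dist x p)\<^sup>2 - ((x - p) \<bullet> l)\<^sup>2 / (l \<bullet> l)"
    using l by (simp add: t_def power2_eq_square field_simps)
  finally have "((x - p) \<bullet> l)\<^sup>2 / (l \<bullet> l) \<le> 0" by simp
  then have "((x - p) \<bullet> l)\<^sup>2 \<le> 0" using l by (simp only: pos_divide_le_eq mult_zero_left)
  then show ?thesis by simp
qed simp

text \<open>By Pythagoras, any other point of \<open>C\<close> is strictly farther away, so the
  definite description in \<open>projector\<close> has exactly one solution. Orthogonality in both
  directions, an equation and not an inequality, suits linear and affine subspaces alike.\<close>

lemma projector_eqI:
  fixes C :: "'a::real_inner set"
  assumes "p \<in> C" "\<And>c. c \<in> C \<Longrightarrow> (x - p) \<bullet> (c - p) = 0"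
  shows "projector C x = p"
proof -
  have pyth: "(dist x c)\<^sup>2 = (dist x p)\<^sup>2 + (dist p c)\<^sup>2" if "c \<in> C" for c
    using norm_add_Pythagorean[of "x - p" "p - c"] assms(2)[OF that]
    by (simp add: dist_norm orthogonal_def inner_diff_right)
  show ?thesis unfolding projector_def
  proof (rule the_equality)
    have "dist x p \<le> dist x c" if "c \<in> C" for c
      using pyth[OF that] by (simp add: power2_le_imp_le)
    then show "p \<in> C \<and> (\<forall>c\<in>C. dist x p \<le> dist x c)" using assms(1) by blast
  next
    fix q assume q: "q \<in> C \<and> (\<forall>c\<in>C. dist x q \<le> dist x c)"
    then have "(dist x q)\<^sup>2 \<le> (dist x p)\<^sup>2" using assms(1) by (intro power_mono) auto
    with pyth[of q] q show "q = p" by simp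
  qed
qed

lemma
  fixes L :: "'a::{real_inner, complete_space} set"
  assumes "closed_subspace L"
  shows projector_in: "projector L x \<in> L"
    and projector_orthogonal: "l \<in> L \<Longrightarrow> (x - projector L x) \<bullet> l = 0"
proof -
  have L: "subspace L" "closed L" using assms by (auto simp: closed_subspace_def)
  obtain p where p: "p \<in> L" "\<forall>c\<in>L. dist x p \<le> dist x c"
    using ex_closest_point[of L x] L subspace_imp_convex subspace_0 by blast
  have o: "(x - p) \<bullet> l = 0" if "l \<in> L" for l
    using closest_point_subspace_orthogonal[OF L(1) p that] .
  have "projector L x = p"
    using p(1) o L(1) by (intro projector_eqI) (auto intro: subspace_diff)
  with p o show "projector L x \<in> L" "l \<in> L \<Longrightarrow> (x - projector L x) \<bullet> l = 0" by auto
qed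

lemma projector_subspace_eqI:
  fixes L :: "'a::real_inner set"
  assumes "subspace L" "p \<in> L" "\<And>l. l \<in> L \<Longrightarrow> (x - p) \<bullet> l = 0"
  shows "projector L x = p"
  using assms by (intro projector_eqI) (auto intro: subspace_diff)

lemma linear_projector:
  fixes L :: "'a::{real_inner, complete_space} set"
  assumes "closed_subspace L"
  shows "linear (projector L)"
proof
  have L: "subspace L" using assms by (simp add: closed_subspace_def)
  fix x y :: 'a and r :: real
  show "projector L (x + y) = projector L x + projector L y"
  proof (rule projector_subspace_eqI[OF L])
    show "projector L x + projector L y \<in> L"
      by (intro subspace_add L projector_in assms)
    show "(x + y - (projector L x + projector L y)) \<bullet> l = 0" if "l \<in> L" for l
      using projector_orthogonal[OF assms that, of x] projector_orthogonal[OF assms that, of y]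
      by (simp add: inner_diff_left inner_add_left)
  qed
  show "projector L (r *\<^sub>R x) = r *\<^sub>R projector L x"
  proof (rule projector_subspace_eqI[OF L])
    show "r *\<^sub>R projector L x \<in> L"
      by (intro subspace_scale L projector_in assms)
    show "(r *\<^sub>R x - r *\<^sub>R projector L x) \<bullet> l = 0" if "l \<in> L" for l
      using projector_orthogonal[OF assms that, of x] by (simp add: inner_diff_left)
  qed
qed

lemma projector_id:
  fixes L :: "'a::{real_inner, complete_space} set"
  assumes "closed_subspace L" "x \<in> L"
  shows "projector L x = x"
  using assms by (intro projector_subspace_eqI) (auto simp: closed_subspace_def)

lemma infdist_eq_norm_projector:
  fixes L :: "'a::{real_inner, complete_space} set"
  assumes "closed_subspace L"
  shows "infdist x L = norm (x - projector L x)"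
proof (rule antisym)
  show "infdist x L \<le> norm (x - projector L x)"
    using infdist_le[OF projector_in[OF assms], of x x] by (simp add: dist_norm)
  have ne: "L \<noteq> {}" using projector_in[OF assms] by blast
  show "norm (x - projector L x) \<le> infdist x L"
    unfolding infdist_notempty[OF ne]
  proof (rule cINF_greatest[OF ne])
    fix c assume "c \<in> L"
    then have "(x - projector L x) \<bullet> (projector L x - c) = 0"
      by (simp add: inner_diff_right projector_orthogonal projector_in assms)
    then have "(dist x c)\<^sup>2 = (norm (x - projector L x))\<^sup>2 + (norm (projector L x - c))\<^sup>2"
      using norm_add_Pythagorean[of "x - projector L x" "projector L x - c"]
      by (simp add: dist_norm orthogonal_def)
    then show "norm (x - projector L x) \<le> dist x c"
      by (simp add: power2_le_imp_le)
  qed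
qed

lemma linear_relaxed_projector:
  fixes L :: "'a::{real_inner, complete_space} set"
  assumes "closed_subspace L"
  shows "linear (relaxed_projector L \<mu>)"
proof -
  have "linear (\<lambda>x. (1 - \<mu>) *\<^sub>R x + \<mu> *\<^sub>R projector L x)"
    by (intro linear_compose_add linear_compose_scale_right linear_ident linear_projector assms)
  then show ?thesis by (simp add: relaxed_projector_def[abs_def])
qed

lemma relaxed_projector_id:
  fixes L :: "'a::{real_inner, complete_space} set"
  assumes "closed_subspace L" "x \<in> L"
  shows "relaxed_projector L \<mu> x = x"
  using assms by (simp add: relaxed_projector_def projector_id algebra_simps)

text \<open>The component of \<open>x\<close> in \<open>L\<close> is kept and the orthogonal one is
  scaled by \<open>1 - \<mu>\<close>; the loss is
  \<open>1 - (1 - \<mu>)\<^sup>2 = \<mu> * (2 - \<mu>)\<close> times the squared norm of the latter.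
  This exact energy balance drives all later estimates.\<close>

lemma norm_relaxed_projector:
  fixes L :: "'a::{real_inner, complete_space} set"
  assumes "closed_subspace L"
  shows "(norm (relaxed_projector L \<mu> x))\<^sup>2 = (norm x)\<^sup>2 - \<mu> * (2 - \<mu>) * (infdist x L)\<^sup>2"
proof -
  define p q where "p = projector L x" and "q = x - p"
  have "q \<bullet> p = 0"
    unfolding p_def q_def by (intro projector_orthogonal projector_in assms)
  moreover have "relaxed_projector L \<mu> x = p + (1 - \<mu>) *\<^sub>R q" "x = p + q"
    by (simp_all add: relaxed_projector_def p_def q_def algebra_simps)
  moreover have "infdist x L = norm q"
    by (simp add: infdist_eq_norm_projector assms p_def q_def)
  moreover have "(norm (p + q))\<^sup>2 = (norm p)\<^sup>2 + (norm q)\<^sup>2"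
    "(norm (p + (1 - \<mu>) *\<^sub>R q))\<^sup>2 = (norm p)\<^sup>2 + (norm ((1 - \<mu>) *\<^sub>R q))\<^sup>2"
    using \<open>q \<bullet> p = 0\<close>
    by (intro norm_add_Pythagorean; simp add: orthogonal_def inner_commute)+
  ultimately show ?thesis
    by (simp add: power_mult_distrib) (simp add: algebra_simps power2_eq_square)
qed

lemma norm_relaxed_projector_le:
  fixes L :: "'a::{real_inner, complete_space} set"
  assumes "closed_subspace L" "0 \<le> \<mu>" "\<mu> \<le> 2"
  shows "norm (relaxed_projector L \<mu> x) \<le> norm x"
proof (rule power2_le_imp_le)
  show "(norm (relaxed_projector L \<mu> x))\<^sup>2 \<le> (norm x)\<^sup>2"
    using assms by (simp add: norm_relaxed_projector)
qed simp

section \<open>Affine subspaces and their translation vectors\<close>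

lemma parallel_subspace_translate:
  fixes L :: "'a::real_inner set"
  assumes "subspace L"
  shows "parallel_subspace ((+) b ` L) = L"
proof
  show "parallel_subspace ((+) b ` L) \<subseteq> L"
    using assms by (auto simp: parallel_subspace_def intro: subspace_diff)
  show "L \<subseteq> parallel_subspace ((+) b ` L)"
  proof
    fix l assume "l \<in> L"
    then have "b + l \<in> (+) b ` L" "b + 0 \<in> (+) b ` L"
      using subspace_0[OF assms] by blast+
    moreover have "l = (b + l) - (b + 0)" by simp
    ultimately show "l \<in> parallel_subspace ((+) b ` L)"
      unfolding parallel_subspace_def by blast
  qed
qed

lemma closed_subspace_parallel:
  "closed_affine_subspace A \<Longrightarrow> closed_subspace (parallel_subspace A)"
  unfolding closed_affine_subspace_def closed_subspace_def
  by (auto simp: parallel_subspace_translate)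

lemma
  fixes A :: "'a::{real_inner, complete_space} set"
  assumes "closed_affine_subspace A"
  shows translation_vector_orthogonal:
      "l \<in> parallel_subspace A \<Longrightarrow> translation_vector A \<bullet> l = 0"
    and affine_eq_translate: "A = (+) (translation_vector A) ` parallel_subspace A"
proof -
  obtain b L where L: "closed_subspace L" and A: "A = (+) b ` L"
    using assms by (auto simp: closed_affine_subspace_def)
  then have sL: "subspace L" and pL: "parallel_subspace A = L"
    by (auto simp: closed_subspace_def parallel_subspace_translate)
  \<comment> \<open>Removing from an arbitrary base point its component in \<open>L\<close> leaves a
    base point orthogonal to \<open>L\<close>. It is the only one: another would differ from it by a
    vector of \<open>L\<close> orthogonal to itself.\<close>
  define a where "a = b - projector L b"
  have ao: "a \<bullet> l = 0" if "l \<in> L" for l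
    unfolding a_def using projector_orthogonal[OF L that] .
  have A': "A = (+) a ` L"
  proof -
    have "b + l = a + (projector L b + l)" "a + l = b + (l - projector L b)" for l
      by (simp_all add: a_def)
    then show ?thesis unfolding A
      using subspace_add[OF sL projector_in[OF L, of b]] subspace_diff[OF sL _ projector_in[OF L, of b]]
      by blast
  qed
  have "translation_vector A = a" unfolding translation_vector_def pL
  proof (rule the_equality)
    have "a \<in> A" unfolding A' using subspace_0[OF sL] by force
    then show "a \<in> orthogonal_comp L \<inter> A"
      using ao by (auto simp: orthogonal_comp_def orthogonal_def inner_commute)
  next
    fix c assume "c \<in> orthogonal_comp L \<inter> A"
    then obtain l where l: "l \<in> L" "c = a + l" "l \<bullet> c = 0"
      by (auto simp: A' orthogonal_comp_def orthogonal_def)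
    then have "l \<bullet> l = 0" using ao[OF l(1)] by (simp add: inner_add_right inner_commute)
    with l show "c = a" by simp
  qed
  then show "l \<in> parallel_subspace A \<Longrightarrow> translation_vector A \<bullet> l = 0"
    "A = (+) (translation_vector A) ` parallel_subspace A" using ao A' pL by metis+
qed

text \<open>As the translation vector is orthogonal to the parallel subspace, the nearest point of
  the affine set is the projection onto that subspace, shifted by this vector.\<close>

lemma relaxed_projector_affine:
  fixes A :: "'a::{real_inner, complete_space} set"
  assumes "closed_affine_subspace A"
  shows "relaxed_projector A \<mu> x
    = relaxed_projector (parallel_subspace A) \<mu> x + \<mu> *\<^sub>R translation_vector A"
proof -
  define L a where "L = parallel_subspace A" and "a = translation_vector A"
  have L: "closed_subspace L" unfolding L_def by (rule closed_subspace_parallel[OF assms])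
  then have sL: "subspace L" by (simp add: closed_subspace_def)
  have A: "A = (+) a ` L" unfolding L_def a_def by (rule affine_eq_translate[OF assms])
  have "projector A x = a + projector L x"
  proof (rule projector_eqI)
    show "a + projector L x \<in> A" unfolding A by (intro imageI projector_in L)
    fix c assume "c \<in> A"
    then obtain l where "l \<in> L" "c = a + l" unfolding A by blast
    moreover from this have "l - projector L x \<in> L" by (intro subspace_diff sL projector_in L)
    ultimately show "(x - (a + projector L x)) \<bullet> (c - (a + projector L x)) = 0"
      using projector_orthogonal[OF L, of "l - projector L x" x]
        translation_vector_orthogonal[OF assms, of "l - projector L x", folded L_def a_def]
      by (simp add: inner_diff_left inner_add_left)
  qed
  then show ?thesis
    unfolding relaxed_projector_def L_def a_def by (simp add: scaleR_add_right)
qed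

text \<open>A step moves \<open>x\<close> only by vectors orthogonal to the parallel subspace. Hence
  an affine orbit of \<open>0\<close> remains orthogonal to all directions common to its sets, where
  the linear parts would not contract.\<close>

lemma inner_relaxed_projector:
  fixes A :: "'a::{real_inner, complete_space} set"
  assumes "closed_affine_subspace A" "v \<in> parallel_subspace A"
  shows "relaxed_projector A \<mu> x \<bullet> v = x \<bullet> v"
  unfolding relaxed_projector_affine[OF assms(1)]
  unfolding relaxed_projector_def
  using projector_orthogonal[OF closed_subspace_parallel[OF assms(1)] assms(2), of x]
    translation_vector_orthogonal[OF assms]
  by (simp add: inner_add_left inner_diff_left algebra_simps)

section \<open>Orbits under words of relaxed projections\<close>

abbreviation relaxed_orbit :: "real \<Rightarrow> 'a::real_inner set list \<Rightarrow> 'a \<Rightarrow> 'a" where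
  "relaxed_orbit \<mu> \<equiv> fold (\<lambda>C. relaxed_projector C \<mu>)"

lemma linear_relaxed_orbit:
  fixes ws :: "'a::{real_inner, complete_space} set list"
  assumes "\<forall>L\<in>set ws. closed_subspace L"
  shows "linear (relaxed_orbit \<mu> ws)"
  using assms
proof (induction ws)
  case Nil
  show ?case using linear_id by (simp add: id_def)
next
  case (Cons L ws)
  then show ?case
    using linear_compose[OF linear_relaxed_projector[of L \<mu>]] by (simp add: o_def)
qed

lemma norm_relaxed_orbit_le:
  fixes ws :: "'a::{real_inner, complete_space} set list"
  assumes "\<forall>L\<in>set ws. closed_subspace L" "0 \<le> \<mu>" "\<mu> \<le> 2"
  shows "norm (relaxed_orbit \<mu> ws x) \<le> norm x"
  using assms(1)
proof (induction ws arbitrary: x)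
  case (Cons L ws)
  then have "norm (relaxed_orbit \<mu> ws (relaxed_projector L \<mu> x)) \<le> norm (relaxed_projector L \<mu> x)"
    by simp
  also have "\<dots> \<le> norm x" using Cons.prems assms by (intro norm_relaxed_projector_le) auto
  finally show ?case by simp
qed simp

lemma relaxed_orbit_id:
  fixes ws :: "'a::{real_inner, complete_space} set list"
  assumes "\<forall>L\<in>set ws. closed_subspace L" "x \<in> \<Inter>(set ws)"
  shows "relaxed_orbit \<mu> ws x = x"
  using assms by (induction ws) (auto simp: relaxed_projector_id)

text \<open>An affine map is its linear part plus its value at \<open>0\<close>. The induction peels
  off the last letter, the outermost map, whose translation then joins the orbit of
  \<open>0\<close>.\<close>

lemma relaxed_orbit_affine:
  fixes ws :: "'a::{real_inner, complete_space} set list"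
  assumes "\<forall>A\<in>set ws. closed_affine_subspace A"
  shows "relaxed_orbit \<mu> ws x
    = relaxed_orbit \<mu> (map parallel_subspace ws) x + relaxed_orbit \<mu> ws 0"
  using assms
proof (induction ws rule: rev_induct)
  case (snoc A ws)
  interpret linear "relaxed_projector (parallel_subspace A) \<mu>"
    using snoc.prems by (intro linear_relaxed_projector closed_subspace_parallel) auto
  have A: "closed_affine_subspace A"
    and IH: "relaxed_orbit \<mu> ws x
      = relaxed_orbit \<mu> (map parallel_subspace ws) x + relaxed_orbit \<mu> ws 0"
    using snoc by auto
  show ?case by (simp add: relaxed_projector_affine[OF A] IH add)
qed simp

lemma inner_relaxed_orbit:
  fixes ws :: "'a::{real_inner, complete_space} set list"
  assumes "\<forall>A\<in>set ws. closed_affine_subspace A" "\<forall>A\<in>set ws. v \<in> parallel_subspace A"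
  shows "relaxed_orbit \<mu> ws x \<bullet> v = x \<bullet> v"
  using assms
  by (induction ws arbitrary: x) (auto simp: inner_relaxed_projector)

section \<open>Regularity, energy loss and contraction\<close>

lemma closed_subspace_Inter:
  "\<forall>L\<in>M. closed_subspace L \<Longrightarrow> closed_subspace (\<Inter>M)"
  unfolding closed_subspace_def by (auto intro: subspace_Inter)

text \<open>A finite family has finitely many subfamilies, so the sum of their constants serves for
  all of them; the added \<open>1\<close> keeps it positive even if there are none.\<close>

lemma innately_regular_uniform:
  fixes \<L> :: "'a::real_inner set set"
  assumes "finite \<L>" "innately_regular \<L>"
  obtains \<kappa> where "\<kappa> > 0"
    "\<And>M x. M \<subseteq> \<L> \<Longrightarrow> M \<noteq> {} \<Longrightarrow> infdist x (\<Inter>M) \<le> \<kappa> * Max ((\<lambda>L. infdist x L) ` M)"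
proof -
  let ?S = "Pow \<L> - {{}}"
  have "\<forall>M\<in>?S. \<exists>k>0. \<forall>x. infdist x (\<Inter>M) \<le> k * Max ((\<lambda>L. infdist x L) ` M)"
    using assms(2) unfolding innately_regular_def regular_collection_def by blast
  then obtain k where k: "M \<in> ?S \<Longrightarrow> k M > 0"
    "M \<in> ?S \<Longrightarrow> infdist x (\<Inter>M) \<le> k M * Max ((\<lambda>L. infdist x L) ` M)" for M x
    by metis
  have fin: "finite ?S" using assms(1) by simp
  show ?thesis
  proof
    show "1 + sum k ?S > 0" using k(1) by (intro add_pos_nonneg sum_nonneg) (auto intro: less_imp_le)
    fix M x assume M: "M \<subseteq> \<L>" "M \<noteq> {}"
    then have MS: "M \<in> ?S" by simp
    have finM: "finite M" using M assms(1) finite_subset by blast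
    obtain L where "L \<in> M" using M by blast
    then have "infdist x L \<le> Max ((\<lambda>L. infdist x L) ` M)" using finM by simp
    then have nn: "0 \<le> Max ((\<lambda>L. infdist x L) ` M)" using infdist_nonneg order_trans by blast
    have "k M \<le> sum k ?S" using k(1) by (intro member_le_sum MS fin) (auto intro: less_imp_le)
    then have "k M * Max ((\<lambda>L. infdist x L) ` M) \<le> (1 + sum k ?S) * Max ((\<lambda>L. infdist x L) ` M)"
      by (intro mult_right_mono nn) simp
    with k(2)[OF MS] show "infdist x (\<Inter>M) \<le> (1 + sum k ?S) * Max ((\<lambda>L. infdist x L) ` M)"
      using order_trans by blast
  qed
qed

text \<open>With \<open>E\<close> the energy lost by the whole orbit, \<open>sqrt K * sqrt E\<close>
  bounds the way travelled before the first use of a subspace, the other root times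
  \<open>sqrt E\<close> the distance to it at that moment, and \<kappa> passes to the intersection.
  \<open>disp\<close> concerns only prefixes that miss some letter, so an induction hypothesis for
  fewer subspaces can supply it.\<close>

lemma infdist_Inter_le_energy_loss:
  fixes ws :: "'a::{real_inner, complete_space} set list"
  assumes sub: "\<forall>L\<in>set ws. closed_subspace L" and "ws \<noteq> []"
    and lam: "0 < lam" "lam < 2" and "0 \<le> \<kappa>"
    and reg: "infdist x (\<Inter>(set ws)) \<le> \<kappa> * Max ((\<lambda>L. infdist x L) ` set ws)"
    and "0 \<le> K"
    and disp: "\<And>us L vs. ws = us @ L # vs \<Longrightarrow> L \<notin> set us \<Longrightarrow>
      (norm (x - relaxed_orbit lam us x))\<^sup>2 \<le> K * ((norm x)\<^sup>2 - (norm (relaxed_orbit lam us x))\<^sup>2)"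
  shows "(infdist x (\<Inter>(set ws)))\<^sup>2 \<le> (\<kappa> * (sqrt K + sqrt (1 / (lam * (2 - lam)))))\<^sup>2
    * ((norm x)\<^sup>2 - (norm (relaxed_orbit lam ws x))\<^sup>2)"
proof -
  define E where "E = (norm x)\<^sup>2 - (norm (relaxed_orbit lam ws x))\<^sup>2"
  have E0: "0 \<le> E"
    unfolding E_def using norm_relaxed_orbit_le[OF sub, of lam x] lam by (simp add: power_mono)
  have lam': "lam * (2 - lam) > 0" using lam by simp
  have "infdist x L \<le> (sqrt K + sqrt (1 / (lam * (2 - lam)))) * sqrt E" if "L \<in> set ws" for L
  proof -
    \<comment> \<open>Stopping before the first use of \<open>L\<close> leaves a shorter orbit that avoids \<open>L\<close>, to which
      the displacement bound for fewer subspaces applies.\<close>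
    obtain us vs where ws: "ws = us @ L # vs" and L: "L \<notin> set us"
      using split_list_first[OF \<open>L \<in> set ws\<close>] by blast
    define y where "y = relaxed_orbit lam us x"
    \<comment> \<open>Norms never increase along the orbit, so the loss before \<open>L\<close> and
      the loss in the step at \<open>L\<close> are each at most \<open>E\<close>.\<close>
    have "relaxed_orbit lam ws x = relaxed_orbit lam vs (relaxed_projector L lam y)"
      by (simp add: ws y_def)
    then have "norm (relaxed_orbit lam ws x) \<le> norm (relaxed_projector L lam y)"
      using sub ws lam by (auto intro!: norm_relaxed_orbit_le)
    then have final: "(norm (relaxed_orbit lam ws x))\<^sup>2 \<le> (norm (relaxed_projector L lam y))\<^sup>2"
      by (simp add: power_mono)
    have cL: "closed_subspace L" using sub that by blast
    have "norm (relaxed_projector L lam y) \<le> norm y" "norm y \<le> norm x"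
      unfolding y_def using cL sub ws lam
      by (auto intro!: norm_relaxed_projector_le norm_relaxed_orbit_le)
    then have mid: "(norm (relaxed_projector L lam y))\<^sup>2 \<le> (norm y)\<^sup>2" "(norm y)\<^sup>2 \<le> (norm x)\<^sup>2"
      by (simp_all add: power_mono)
    have "(norm (x - y))\<^sup>2 \<le> K * ((norm x)\<^sup>2 - (norm y)\<^sup>2)"
      unfolding y_def by (rule disp[OF ws L])
    also have "\<dots> \<le> K * E"
      using final mid \<open>0 \<le> K\<close> unfolding E_def by (intro mult_left_mono) linarith+
    finally have 1: "norm (x - y) \<le> sqrt K * sqrt E"
      by (simp add: real_sqrt_mult[symmetric] real_le_rsqrt)
    have "lam * (2 - lam) * (infdist y L)\<^sup>2 \<le> E"
      using norm_relaxed_projector[OF cL, of lam y] final mid unfolding E_def by linarith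
    then have "(infdist y L)\<^sup>2 \<le> 1 / (lam * (2 - lam)) * E"
      using lam' by (simp add: field_simps)
    then have 2: "infdist y L \<le> sqrt (1 / (lam * (2 - lam))) * sqrt E"
      by (simp only: real_sqrt_mult[symmetric] real_le_rsqrt)
    have "infdist x L \<le> infdist y L + dist x y" by (rule infdist_triangle)
    with 1 2 show ?thesis by (simp add: dist_norm distrib_right)
  qed
  then have "Max ((\<lambda>L. infdist x L) ` set ws) \<le> (sqrt K + sqrt (1 / (lam * (2 - lam)))) * sqrt E"
    using \<open>ws \<noteq> []\<close> by simp
  then have "infdist x (\<Inter>(set ws)) \<le> \<kappa> * ((sqrt K + sqrt (1 / (lam * (2 - lam)))) * sqrt E)"
    using reg \<open>0 \<le> \<kappa>\<close> mult_left_mono order_trans by blast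
  then have "(infdist x (\<Inter>(set ws)))\<^sup>2
      \<le> (\<kappa> * (sqrt K + sqrt (1 / (lam * (2 - lam)))) * sqrt E)\<^sup>2"
    by (intro power_mono infdist_nonneg) (simp add: mult.assoc)
  also have "\<dots> = (\<kappa> * (sqrt K + sqrt (1 / (lam * (2 - lam)))))\<^sup>2 * E"
    using E0 by (simp add: power_mult_distrib)
  finally show ?thesis unfolding E_def .
qed

lemma displacement_le_energy_loss:
  fixes \<L> :: "'a::{real_inner, complete_space} set set"
  assumes "finite \<L>" and sub: "\<forall>L\<in>\<L>. closed_subspace L"
    and "innately_regular \<L>" and lam: "0 < lam" "lam < 2"
  shows "\<exists>K\<ge>0. \<forall>ws x. set ws \<subseteq> \<L> \<longrightarrow>
    (norm (x - relaxed_orbit lam ws x))\<^sup>2 \<le> K * ((norm x)\<^sup>2 - (norm (relaxed_orbit lam ws x))\<^sup>2)"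
proof -
  obtain \<kappa> where \<kappa>: "\<kappa> > 0"
    "\<And>M x. M \<subseteq> \<L> \<Longrightarrow> M \<noteq> {} \<Longrightarrow> infdist x (\<Inter>M) \<le> \<kappa> * Max ((\<lambda>L. infdist x L) ` M)"
    using innately_regular_uniform[OF assms(1,3)] by blast
  \<comment> \<open>Counting distinct letters instead of length lets the constant grow only
    \<open>card \<L>\<close> times, however long the word is.\<close>
  have "\<exists>K\<ge>0. \<forall>ws x. set ws \<subseteq> \<L> \<and> card (set ws) \<le> n \<longrightarrow>
    (norm (x - relaxed_orbit lam ws x))\<^sup>2 \<le> K * ((norm x)\<^sup>2 - (norm (relaxed_orbit lam ws x))\<^sup>2)"
    for n
  proof (induction n)
    case 0
    show ?case by (intro exI[of _ 0]) simp
  next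
    case (Suc n)
    then obtain K where K: "K \<ge> 0" "\<And>ws x. set ws \<subseteq> \<L> \<Longrightarrow> card (set ws) \<le> n \<Longrightarrow>
      (norm (x - relaxed_orbit lam ws x))\<^sup>2 \<le> K * ((norm x)\<^sup>2 - (norm (relaxed_orbit lam ws x))\<^sup>2)"
      by blast
    define K' where "K' = (\<kappa> * (sqrt K + sqrt (1 / (lam * (2 - lam)))))\<^sup>2"
    have "(norm (x - relaxed_orbit lam ws x))\<^sup>2
        \<le> 4 * K' * ((norm x)\<^sup>2 - (norm (relaxed_orbit lam ws x))\<^sup>2)"
      if ws: "set ws \<subseteq> \<L>" "card (set ws) \<le> Suc n" for ws x
    proof (cases "ws = []")
      case False
      have subw: "\<forall>L\<in>set ws. closed_subspace L" using ws sub by blast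
      define V p where "V = \<Inter>(set ws)" and "p = projector V x"
      have V: "closed_subspace V" unfolding V_def by (rule closed_subspace_Inter[OF subw])
      interpret linear "relaxed_orbit lam ws" by (rule linear_relaxed_orbit[OF subw])
      \<comment> \<open>The orbit map is linear and fixes \<open>p\<close>, so \<open>x\<close> and
        \<open>x - p\<close> are displaced equally. Nonexpansiveness bounds this by twice the
        distance to \<open>V\<close>; squaring yields the factor 4.\<close>
      have "relaxed_orbit lam ws p = p"
        using projector_in[OF V, of x] unfolding V_def p_def by (rule relaxed_orbit_id[OF subw])
      then have "x - relaxed_orbit lam ws x = (x - p) - relaxed_orbit lam ws (x - p)"
        by (simp add: diff)
      also have "norm \<dots> \<le> norm (x - p) + norm (relaxed_orbit lam ws (x - p))"
        by (rule norm_triangle_ineq4)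
      also have "\<dots> \<le> 2 * norm (x - p)"
        using norm_relaxed_orbit_le[OF subw, of lam "x - p"] lam by simp
      also have "\<dots> = 2 * infdist x V" by (simp add: p_def infdist_eq_norm_projector[OF V])
      finally have "(norm (x - relaxed_orbit lam ws x))\<^sup>2 \<le> (2 * infdist x V)\<^sup>2"
        by (intro power_mono) auto
      also have "\<dots> = 4 * (infdist x V)\<^sup>2" by (simp add: power_mult_distrib)
      also have "(infdist x V)\<^sup>2 \<le> K' * ((norm x)\<^sup>2 - (norm (relaxed_orbit lam ws x))\<^sup>2)"
        unfolding V_def K'_def
      proof (rule infdist_Inter_le_energy_loss[OF subw False lam])
        show "infdist x (\<Inter>(set ws)) \<le> \<kappa> * Max ((\<lambda>L. infdist x L) ` set ws)"
          using False ws by (intro \<kappa>(2)) auto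
        fix us L vs assume *: "ws = us @ L # vs" "L \<notin> set us"
        then have "set us \<subset> set ws" by auto
        then have "card (set us) < card (set ws)" by (intro psubset_card_mono) auto
        then show "(norm (x - relaxed_orbit lam us x))\<^sup>2
            \<le> K * ((norm x)\<^sup>2 - (norm (relaxed_orbit lam us x))\<^sup>2)"
          using * ws by (intro K(2)) auto
      qed (use \<kappa>(1) K(1) in auto)
      finally show ?thesis by simp
    qed simp
    moreover have "4 * K' \<ge> 0" by (simp add: K'_def)
    ultimately show ?case by blast
  qed
  from this[of "card \<L>"] show ?thesis by (meson assms(1) card_mono)
qed

text \<open>If \<open>x\<close> is orthogonal to the intersection, its distance to it is
  \<open>norm x\<close>. The energy estimate then bounds the squared norm of \<open>x\<close> by
  \<open>K'\<close> times the loss, and solving for the final norm gives the factor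
  \<open>sqrt (1 - 1 / K')\<close>, the same for all words.\<close>

lemma relaxed_orbit_contraction:
  fixes \<L> :: "'a::{real_inner, complete_space} set set"
  assumes "finite \<L>" and sub: "\<forall>L\<in>\<L>. closed_subspace L"
    and "innately_regular \<L>" and lam: "0 < lam" "lam < 2"
  obtains c where "0 \<le> c" "c < 1"
    "\<And>ws x. set ws \<subseteq> \<L> \<Longrightarrow> ws \<noteq> [] \<Longrightarrow> (\<And>v. v \<in> \<Inter>(set ws) \<Longrightarrow> x \<bullet> v = 0) \<Longrightarrow>
      norm (relaxed_orbit lam ws x) \<le> c * norm x"
proof -
  obtain \<kappa> where \<kappa>: "\<kappa> > 0"
    "\<And>M x. M \<subseteq> \<L> \<Longrightarrow> M \<noteq> {} \<Longrightarrow> infdist x (\<Inter>M) \<le> \<kappa> * Max ((\<lambda>L. infdist x L) ` M)"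
    using innately_regular_uniform[OF assms(1,3)] by blast
  obtain K where K: "K \<ge> 0" "\<And>ws x. set ws \<subseteq> \<L> \<Longrightarrow>
    (norm (x - relaxed_orbit lam ws x))\<^sup>2 \<le> K * ((norm x)\<^sup>2 - (norm (relaxed_orbit lam ws x))\<^sup>2)"
    using displacement_le_energy_loss[OF assms] by blast
  \<comment> \<open>The added \<open>1\<close> makes \<open>K' \<ge> 1\<close>, so that
    \<open>1 - 1 / K'\<close> is nonnegative and its root is a valid factor.\<close>
  define K' where "K' = 1 + (\<kappa> * (sqrt K + sqrt (1 / (lam * (2 - lam)))))\<^sup>2"
  have K': "K' \<ge> 1" by (simp add: K'_def)
  show ?thesis
  proof (rule that[of "sqrt (1 - 1 / K')"])
    show "0 \<le> sqrt (1 - 1 / K')" "sqrt (1 - 1 / K') < 1" using K' by auto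
    fix ws :: "'a set list" and x
    assume ws: "set ws \<subseteq> \<L>" "ws \<noteq> []" and orth: "\<And>v. v \<in> \<Inter>(set ws) \<Longrightarrow> x \<bullet> v = 0"
    define E where "E = (norm x)\<^sup>2 - (norm (relaxed_orbit lam ws x))\<^sup>2"
    have subw: "\<forall>L\<in>set ws. closed_subspace L" using ws sub by blast
    have V: "closed_subspace (\<Inter>(set ws))" by (rule closed_subspace_Inter[OF subw])
    then have "projector (\<Inter>(set ws)) x = 0"
      using orth by (intro projector_subspace_eqI) (simp_all add: closed_subspace_def subspace_0 del: Inter_iff)
    then have "(norm x)\<^sup>2 = (infdist x (\<Inter>(set ws)))\<^sup>2"
      by (simp add: infdist_eq_norm_projector[OF V])
    also have "\<dots> \<le> (\<kappa> * (sqrt K + sqrt (1 / (lam * (2 - lam)))))\<^sup>2 * E"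
      unfolding E_def
      using ws K \<kappa> by (intro infdist_Inter_le_energy_loss[OF subw ws(2) lam]) auto
    also have "\<dots> \<le> K' * E"
      using norm_relaxed_orbit_le[OF subw, of lam x] lam
      by (intro mult_right_mono) (simp_all add: K'_def E_def power_mono)
    finally have "(norm (relaxed_orbit lam ws x))\<^sup>2 \<le> (1 - 1 / K') * (norm x)\<^sup>2"
      using K' by (simp add: E_def field_simps)
    then have "norm (relaxed_orbit lam ws x) \<le> sqrt ((1 - 1 / K') * (norm x)\<^sup>2)"
      by (rule real_le_rsqrt)
    then show "norm (relaxed_orbit lam ws x) \<le> sqrt (1 - 1 / K') * norm x"
      by (simp add: real_sqrt_mult)
  qed
qed

section \<open>Boundedness of affine orbits of the origin\<close>

lemma split_list_minimal_suffix:
  "ws \<noteq> [] \<Longrightarrow> \<exists>us y vs. ws = us @ y # vs \<and> y \<notin> set vs \<and> set (y # vs) = set ws"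
proof (induction ws)
  case (Cons z ws)
  \<comment> \<open>If the head recurs, the tail already contains every letter and its suffix
    serves; otherwise the whole list is the suffix.\<close>
  show ?case
  proof (cases "z \<in> set ws")
    case True
    then obtain us y vs where "ws = us @ y # vs" "y \<notin> set vs" "set (y # vs) = set ws"
      using Cons.IH by (metis empty_iff list.set(1))
    with True show ?thesis by (intro exI[of _ "z # us"] exI[of _ y] exI[of _ vs]) auto
  next
    case False
    then show ?thesis by (intro exI[of _ "[]"]) auto
  qed
qed simp

lemma relaxed_orbit_bounded:
  fixes \<A> :: "'a::{real_inner, complete_space} set set"
  assumes "finite \<A>" and aff: "\<forall>A\<in>\<A>. closed_affine_subspace A"
    and "innately_regular (parallel_subspace ` \<A>)" and lam: "0 < lam" "lam < 2"
  shows "\<exists>C\<ge>0. \<forall>ws. set ws \<subseteq> \<A> \<longrightarrow> norm (relaxed_orbit lam ws 0) \<le> C"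
proof -
  obtain c where c: "0 \<le> c" "c < 1"
    "\<And>ws x. set ws \<subseteq> parallel_subspace ` \<A> \<Longrightarrow> ws \<noteq> [] \<Longrightarrow>
      (\<And>v. v \<in> \<Inter>(set ws) \<Longrightarrow> x \<bullet> v = 0) \<Longrightarrow> norm (relaxed_orbit lam ws x) \<le> c * norm x"
    using relaxed_orbit_contraction[of "parallel_subspace ` \<A>" lam] assms closed_subspace_parallel
    by blast
  \<comment> \<open>A bound for how far one step from any set of the family moves the
    origin.\<close>
  define \<alpha> where "\<alpha> = (\<Sum>A\<in>\<A>. norm (relaxed_projector A lam 0))"
  have \<alpha>: "norm (relaxed_projector A lam 0) \<le> \<alpha>" if "A \<in> \<A>" for A
    unfolding \<alpha>_def using that assms(1) by (intro member_le_sum) auto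
  have \<alpha>0: "0 \<le> \<alpha>" unfolding \<alpha>_def by (simp add: sum_nonneg)
  have "\<exists>C\<ge>0. \<forall>ws. set ws \<subseteq> \<A> \<and> card (set ws) \<le> n \<longrightarrow> norm (relaxed_orbit lam ws 0) \<le> C" for n
  proof (induction n)
    case 0
    show ?case by (intro exI[of _ 0]) simp
  next
    case (Suc n)
    then obtain C where C: "C \<ge> 0"
      "\<And>ws. set ws \<subseteq> \<A> \<Longrightarrow> card (set ws) \<le> n \<Longrightarrow> norm (relaxed_orbit lam ws 0) \<le> C"
      by blast
    \<comment> \<open>the fixed point of \<open>t \<mapsto> c * t + (\<alpha> + C)\<close>\<close>
    define \<beta> where "\<beta> = (\<alpha> + C) / (1 - c)"
    have \<beta>: "c * \<beta> + (\<alpha> + C) = \<beta>" using c(2) by (simp add: \<beta>_def field_simps)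
    have \<beta>0: "0 \<le> \<beta>" using c(2) C(1) \<alpha>0 by (simp add: \<beta>_def)
    \<comment> \<open>A second induction, on length: the prefix before the minimal suffix is shorter
      but may use just as many sets, so it has to be bounded by \<beta> itself.\<close>
    have "norm (relaxed_orbit lam ws 0) \<le> \<beta>" if "set ws \<subseteq> \<A>" "card (set ws) \<le> Suc n" for ws
      using that
    proof (induction ws rule: length_induct)
      case (1 ws)
      show ?case
      proof (cases "ws = []")
        case False
        then obtain us y vs where ws: "ws = us @ y # vs" "y \<notin> set vs" "set (y # vs) = set ws"
          using split_list_minimal_suffix by blast
        have affw: "\<forall>A\<in>set ws. closed_affine_subspace A" using 1(2) aff by blast
        define z where "z = relaxed_orbit lam us 0"
        have "set us \<subseteq> set ws" using ws(1) by auto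
        then have "card (set us) \<le> card (set ws)" by (intro card_mono) auto
        then have z: "norm z \<le> \<beta>"
          unfolding z_def using 1 \<open>set us \<subseteq> set ws\<close> ws(1) by simp
        \<comment> \<open>Every set used in the prefix \<open>us\<close> occurs again in the suffix,
          so \<open>z\<close> is orthogonal to the intersection belonging to the suffix, as the
          contraction demands.\<close>
        have z_orth: "z \<bullet> v = 0" if "v \<in> \<Inter>(set (map parallel_subspace (y # vs)))" for v
        proof -
          have "\<forall>A\<in>set us. v \<in> parallel_subspace A"
            using that \<open>set us \<subseteq> set ws\<close> unfolding ws(3)[symmetric] by auto
          then show ?thesis
            unfolding z_def using affw \<open>set us \<subseteq> set ws\<close> by (subst inner_relaxed_orbit) auto
        qed
        have lin: "norm (relaxed_orbit lam (map parallel_subspace (y # vs)) z) \<le> c * \<beta>"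
        proof -
          have "norm (relaxed_orbit lam (map parallel_subspace (y # vs)) z) \<le> c * norm z"
            using ws(3) 1(2) z_orth by (intro c(3)) auto
          also have "\<dots> \<le> c * \<beta>" using z c(1) by (intro mult_left_mono)
          finally show ?thesis .
        qed
        \<comment> \<open>The letter \<open>y\<close> sends \<open>0\<close> to a point of norm at
          most \<alpha>, which the linear part of \<open>vs\<close> does not enlarge. The constant
          part of \<open>vs\<close> falls under the outer induction, since \<open>vs\<close> avoids
          \<open>y\<close>.\<close>
        have "relaxed_orbit lam (y # vs) 0
            = relaxed_orbit lam (map parallel_subspace vs) (relaxed_projector y lam 0)
              + relaxed_orbit lam vs 0"
          using affw ws(1) relaxed_orbit_affine[of vs lam "relaxed_projector y lam 0"] by auto
        moreover have "norm (relaxed_orbit lam (map parallel_subspace vs) (relaxed_projector y lam 0)) \<le> \<alpha>"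
        proof (rule order_trans[OF norm_relaxed_orbit_le \<alpha>])
          show "\<forall>L\<in>set (map parallel_subspace vs). closed_subspace L"
            using affw ws(1) closed_subspace_parallel by auto
        qed (use ws(1) 1(2) lam in auto)
        moreover have "norm (relaxed_orbit lam vs 0) \<le> C"
        proof (rule C(2))
          have "set vs \<subset> set ws" using ws by auto
          then have "card (set vs) < card (set ws)" by (intro psubset_card_mono) auto
          with 1(3) show "card (set vs) \<le> n" by simp
          show "set vs \<subseteq> \<A>" using ws(1) 1(2) by auto
        qed
        ultimately have const: "norm (relaxed_orbit lam (y # vs) 0) \<le> \<alpha> + C"
          by (metis norm_triangle_mono)
        have "relaxed_orbit lam ws 0 = relaxed_orbit lam (y # vs) z"
          by (simp add: ws(1) z_def)
        also have "\<dots> = relaxed_orbit lam (map parallel_subspace (y # vs)) z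
            + relaxed_orbit lam (y # vs) 0"
          using affw ws(3) by (intro relaxed_orbit_affine) simp
        also have "norm \<dots> \<le> c * \<beta> + (\<alpha> + C)"
          by (rule norm_triangle_mono[OF lin const])
        finally show ?thesis by (simp only: \<beta>)
      qed (simp add: \<beta>0)
    qed
    with \<beta>0 show ?case by blast
  qed
  from this[of "card \<A>"] show ?thesis by (meson assms(1) card_mono)
qed

section \<open>From orbits of the origin to the partial sums and iterates\<close>

theorem theorem4p3:
  fixes \<A> :: "'a::{real_inner, complete_space} set set" and lam :: real
  assumes "finite \<A>" and "\<A> \<noteq> {}"
    and "\<And>A. A \<in> \<A> \<Longrightarrow> closed_affine_subspace A"
    and "innately_regular (parallel_subspace ` \<A>)"
    and "0 < lam" and "lam < 2"
  shows "\<exists>C>0. \<forall>(A :: nat \<Rightarrow> 'a set) (L :: nat \<Rightarrow> 'a set) (a :: nat \<Rightarrow> 'a)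
             (R :: nat \<Rightarrow> 'a \<Rightarrow> 'a) (x :: nat \<Rightarrow> 'a).
           (\<forall>n. A n \<in> \<A>) \<longrightarrow>
           (\<forall>n. L n = parallel_subspace (A n)) \<longrightarrow>
           (\<forall>n. a n = translation_vector (A n)) \<longrightarrow>
           (\<forall>n. R n = relaxed_projector (L n) lam) \<longrightarrow>
           (\<forall>n. x (Suc n) = relaxed_projector (A n) lam (x n)) \<longrightarrow>
             (\<forall>n. relaxed_projector (A n) lam (x n) = R n (x n) + lam *\<^sub>R a n) \<and>
             (\<forall>n. norm (\<Sum>j\<le>n. fold R [Suc j..<Suc n] (a j)) \<le> C) \<and>
             (\<forall>n. norm (x n) \<le> norm (x 0) + lam * C)"
proof -
  obtain C where C: "C \<ge> 0" "\<And>ws. set ws \<subseteq> \<A> \<Longrightarrow> norm (relaxed_orbit lam ws 0) \<le> C"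
    using relaxed_orbit_bounded[of \<A> lam] assms by blast
  show ?thesis
  \<comment> \<open>The orbits of \<open>0\<close> are \<open>lam\<close> times the partial sums,
    hence the division; the \<open>1\<close> gives positivity when \<open>C = 0\<close>.\<close>
  proof (intro exI[of _ "C / lam + 1"] conjI allI impI)
    show "0 < C / lam + 1" using C(1) assms(5) by (intro add_nonneg_pos) auto
    fix A L :: "nat \<Rightarrow> 'a set" and a x :: "nat \<Rightarrow> 'a" and R :: "nat \<Rightarrow> 'a \<Rightarrow> 'a" and n
    assume A: "\<forall>n. A n \<in> \<A>" and L: "\<forall>n. L n = parallel_subspace (A n)"
      and a: "\<forall>n. a n = translation_vector (A n)"
      and R: "\<forall>n. R n = relaxed_projector (L n) lam"
      and x: "\<forall>n. x (Suc n) = relaxed_projector (A n) lam (x n)"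
    have aff: "closed_affine_subspace (A n)" for n using A assms(3) by blast
    have step: "relaxed_projector (A n) lam y = R n y + lam *\<^sub>R a n" for n y
      using relaxed_projector_affine[OF aff] by (simp add: R L a)
    then show "relaxed_projector (A n) lam (x n) = R n (x n) + lam *\<^sub>R a n" .
    have linR: "linear (R n)" for n
      unfolding R[rule_format] L[rule_format]
      by (intro linear_relaxed_projector closed_subspace_parallel aff)
    \<comment> \<open>\<open>fold\<close> applies \<open>R (Suc j)\<close> first and
      \<open>R n\<close> last, as in the product; for \<open>j = n\<close> the list is empty and the
      factor is the identity.\<close>
    define s where "s n = (\<Sum>j\<le>n. fold R [Suc j..<Suc n] (a j))" for n
    have s_Suc: "s (Suc n) = R (Suc n) (s n) + a (Suc n)" for n
      by (simp add: s_def linear_sum[OF linR])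
    \<comment> \<open>By \<open>s_Suc\<close>, \<open>lam *\<^sub>R s n\<close> satisfies the
      recursion of the affine iteration from \<open>0\<close>. The sum up to \<open>n\<close>
      includes \<open>a n\<close>, so the word has \<open>n + 1\<close> letters.\<close>
    have s_orbit: "lam *\<^sub>R s n = relaxed_orbit lam (map A [0..<Suc n]) 0" for n
    proof (induction n)
      case 0
      show ?case using step[of 0 0] linear_0[OF linR] by (simp add: s_def)
    next
      case (Suc n)
      have "relaxed_orbit lam (map A [0..<Suc (Suc n)]) 0
          = relaxed_projector (A (Suc n)) lam (lam *\<^sub>R s n)"
        by (simp add: Suc.IH)
      then show ?case
        by (simp add: step s_Suc linear_scale[OF linR] scaleR_add_right)
    qed
    have "lam * norm (s n) \<le> C"
    proof -
      have "norm (lam *\<^sub>R s n) \<le> C" unfolding s_orbit using A by (intro C(2)) auto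
      then show ?thesis using assms(5) by simp
    qed
    then have "norm (s n) \<le> C / lam" using assms(5) by (simp add: field_simps)
    then show "norm (\<Sum>j\<le>n. fold R [Suc j..<Suc n] (a j)) \<le> C / lam + 1"
      unfolding s_def by linarith
    \<comment> \<open>In contrast to \<open>s n\<close>, the iterate \<open>x n\<close> has used
      only the first \<open>n\<close> sets. Its linear part is nonexpansive in \<open>x 0\<close>,
      and its constant part is again an orbit of \<open>0\<close>.\<close>
    have x_orbit: "x n = relaxed_orbit lam (map A [0..<n]) (x 0)"
      by (induction n) (simp_all add: x)
    also have "\<dots> = relaxed_orbit lam (map parallel_subspace (map A [0..<n])) (x 0)
        + relaxed_orbit lam (map A [0..<n]) 0"
      using aff by (intro relaxed_orbit_affine) auto
    also have "norm \<dots> \<le> norm (x 0) + C"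
    proof (rule norm_triangle_mono)
      show "norm (relaxed_orbit lam (map parallel_subspace (map A [0..<n])) (x 0)) \<le> norm (x 0)"
        using aff closed_subspace_parallel assms(5,6) by (intro norm_relaxed_orbit_le) auto
      show "norm (relaxed_orbit lam (map A [0..<n]) 0) \<le> C" using A by (intro C(2)) auto
    qed
    finally show "norm (x n) \<le> norm (x 0) + lam * (C / lam + 1)"
      using assms(5) by (simp add: distrib_left)
  qed
qed

end
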